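(* Let $\Omega\subseteq\mathbb{R}^3$ be an open, bounded, simply connected polyhedral region, let $\mathcal{T}$ be a tetrahedral mesh of $\Omega$, and for $n\in\mathbb{N}$ let $\mathcal{Q}^{n}\mathcal{T}$ be the mesh obtained from $\mathcal{T}$ by $n$ levels of QLRS refinement. Then the sequence of meshes $\{\mathcal{B}\mathcal{Q}^{n}\mathcal{T}:n\in\mathbb{N}\}$, where $\mathcal{B}$ denotes bipartite refinement, has bounded regularity; moreover, there exists a positive constant $\kappa$ such that $$\sup_{n\in\mathbb{N}}\max\{\zeta_{L}:L\in\mathcal{B}\mathcal{Q}^{n}\mathcal{T}\}\leq\frac{\kappa}{\eta^{3}},$$ where $\eta=\min\{\eta_{\Delta}:\Delta\in\mathcal{T}\}$.
   Context: A tetrahedral mesh of a bounded open polyhedral domain $\mathcal{O}\subseteq\mathbb{R}^3$ is a finite conforming family of closed non-degenerate tetrahedra whose union is the closure of $\mathcal{O}$. For a non-degenerate tetrahedron $\Delta$: $h_\Delta$ is its diameter, $\rho_\Delta=\sup\{\text{diameter of }B: B\text{ is a ball contained in }\Delta\}$, its regularity is $\zeta_\Delta=h_\Delta/\rho_\Delta$, and its mean ratio is $$\eta_\Delta=\frac{12\,(3|\Delta|_3)^{2/3}}{\sum\{|\sigma|^2:\sigma\text{ is an edge of }\Delta\}},$$ where $|\Delta|_3$ is the volume and $|\sigma|$ the length of the edge $\sigma$. A sequence of meshes has bounded regularity if the values $\zeta_L$, over all elements $L$ of all the meshes, are bounded above. Bipartite refinement: if $\Delta$ has vertices $\mathbf{v}_1,\dots,\mathbf{v}_4$,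 then for each permutation $\pi\in S_4$ set $\Delta_\pi=\mathrm{co}\{\frac1i\sum_{\ell=1}^{i}\mathbf{v}_{\pi(\ell)}:1\le i\le4\}$ (convex hull). The bipartite gridding of $\Delta$ is $\mathcal{B}\Delta=\{\Delta_\pi:\pi\in S_4\}$. For a tetrahedral mesh $\mathcal{M}$, its bipartite refinement $\mathcal{B}\mathcal{M}$ is the mesh obtained by applying the bipartite gridding to each tetrahedron of $\mathcal{M}$. QLRS refinement: QLRS (quality local refinement based on subdivision) is an algorithm of Liu and Joe that refines tetrahedral meshes. It enters this statement only through the following known property, to be taken as the defining assumption on the meshes $\mathcal{Q}^n\mathcal{T}$: for every $n$, $\mathcal{Q}^n\mathcal{T}$ is a tetrahedral mesh of $\Omega$ such that each $K\in\mathcal{Q}^n\mathcal{T}$ is contained in some $\Delta\in\mathcal{T}$, and for such $K\subseteq\Delta$, $$\eta_K\geq\frac{\sqrt[3]{4}}{11}\,\eta_\Delta.$$ The following known inequality relating the shape parameters is also available: $\zeta_\Delta\le 3/\eta_\Delta^3$ for every non-degenerate tetrahedron $\Delta$. *)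

theory Defs
  imports "HOL-Analysis.Analysis" "HOL-Combinatorics.Permutations"
begin

type_synonym mesh = "(real ^ 3) set set"

text \<open>The members of \<open>F\<close> are the faces (convex polygons) of the boundary. Their dimension need not be
  restricted, since the frontier of an open set has empty interior.\<close>

definition polyhedral_region :: "(real ^ 3) set \<Rightarrow> bool" where
  "polyhedral_region \<Omega> \<longleftrightarrow>
     open \<Omega> \<and> bounded \<Omega> \<and> \<Omega> \<noteq> {} \<and>
     (\<exists>F. finite F \<and> (\<forall>P\<in>F. polytope P) \<and> frontier \<Omega> = \<Union>F)"

abbreviation tetrahedron :: "(real ^ 3) set \<Rightarrow> bool" where
  "tetrahedron \<Delta> \<equiv> 3 simplex \<Delta>"

text \<open>Finiteness and conformity are both part of \<^const>\<open>triangulation\<close>: any two elements meet in a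
  (possibly empty) common face.\<close>

definition tetrahedral_mesh :: "(real ^ 3) set \<Rightarrow> mesh \<Rightarrow> bool" where
  "tetrahedral_mesh \<Omega> M \<longleftrightarrow>
     triangulation M \<and> (\<forall>\<Delta>\<in>M. tetrahedron \<Delta>) \<and> \<Union>M = closure \<Omega>"

definition inball_diameter :: "(real ^ 3) set \<Rightarrow> real" where
  "inball_diameter \<Delta> = Sup {diameter (cball c r) | c r. 0 < r \<and> cball c r \<subseteq> \<Delta>}"

definition regularity :: "(real ^ 3) set \<Rightarrow> real" where
  "regularity \<Delta> = diameter \<Delta> / inball_diameter \<Delta>"

text \<open>The length of an edge (a segment) is its diameter.\<close>

definition mean_ratio :: "(real ^ 3) set \<Rightarrow> real" where
  "mean_ratio \<Delta> =
     12 * (3 * measure lebesgue \<Delta>) powr (2/3) / (\<Sum>\<sigma> | \<sigma> edge_of \<Delta>. (diameter \<sigma>)\<^sup>2)"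

definition bounded_regularity :: "(nat \<Rightarrow> mesh) \<Rightarrow> bool" where
  "bounded_regularity M \<longleftrightarrow> bdd_above (regularity ` (\<Union>n. M n))"

definition bipartite_cell :: "(nat \<Rightarrow> real ^ 3) \<Rightarrow> (nat \<Rightarrow> nat) \<Rightarrow> (real ^ 3) set" where
  "bipartite_cell v \<pi> = convex hull ((\<lambda>i. (1 / real i) *\<^sub>R (\<Sum>l=1..i. v (\<pi> l))) ` {1..4})"

text \<open>The set ranges over all labellings \<open>v\<close> of the four vertices; each labelling already yields all
  cells, because relabelling the vertices only permutes the \<open>\<pi>\<close>.\<close>

definition bipartite_gridding :: "(real ^ 3) set \<Rightarrow> mesh" where
  "bipartite_gridding \<Delta> =
     {bipartite_cell v \<pi> | v \<pi>.
        bij_betw v {1..4} {x. x extreme_point_of \<Delta>} \<and> \<pi> permutes {1..4}}"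

definition bipartite_refinement :: "mesh \<Rightarrow> mesh" where
  "bipartite_refinement M = (\<Union>\<Delta>\<in>M. bipartite_gridding \<Delta>)"

text \<open>The QLRS algorithm is represented by its known guarantee: \<open>Q n\<close> stands for the mesh after \<open>n\<close>
  levels of refinement of \<open>T\<close>, and may be any sequence of meshes with the property below.\<close>

definition qlrs_meshes :: "(real ^ 3) set \<Rightarrow> mesh \<Rightarrow> (nat \<Rightarrow> mesh) \<Rightarrow> bool" where
  "qlrs_meshes \<Omega> T Q \<longleftrightarrow>
     (\<forall>n. tetrahedral_mesh \<Omega> (Q n) \<and>
          (\<forall>K\<in>Q n. \<exists>\<Delta>\<in>T. K \<subseteq> \<Delta>) \<and>
          (\<forall>K\<in>Q n. \<forall>\<Delta>\<in>T. K \<subseteq> \<Delta> \<longrightarrow> mean_ratio K \<ge> root 3 4 / 11 * mean_ratio \<Delta>))"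

end

theory Submission
  imports Defs
begin

text \<open>Let \<open>K\<close> be a tetrahedron of diameter \<open>h\<close> and volume \<open>V\<close>. In barycentric coordinates the cells of
  the bipartite gridding of \<open>K\<close> are the chambers
  \<open>\<lambda>\<^sub>1 \<ge> \<lambda>\<^sub>2 \<ge> \<lambda>\<^sub>3 \<ge> \<lambda>\<^sub>4 \<ge> 0\<close>. By Cramer's rule a displacement \<open>y\<close> changes each
  barycentric coordinate by a multiple of \<open>|y| h\<^sup>2 / V\<close>, so every cell contains a ball of radius
  proportional to \<open>V / h\<^sup>2\<close> and has regularity \<open>O(h\<^sup>3 / V)\<close>. As the longest edge of \<open>K\<close> has length
  \<open>h\<close>, this is \<open>O(\<eta>\<^sub>K\<^sup>-\<^sup>3)\<close>, and the QLRS guarantee replaces \<open>\<eta>\<^sub>K\<close> by \<open>\<eta>\<close>.\<close>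

section \<open>A ball inside each chamber of the bipartite gridding\<close>

unbundle cross3_syntax

text \<open>Cramer's rule with the denominator cleared, so that it needs no independence of
  \<open>a\<close>, \<open>b\<close>, \<open>c\<close>.\<close>

lemma cramer_cross3:
  fixes a b c y :: "real ^ 3"
  shows "(a \<bullet> (b \<times> c)) *\<^sub>R y =
    (y \<bullet> (b \<times> c)) *\<^sub>R a + (y \<bullet> (c \<times> a)) *\<^sub>R b + (y \<bullet> (a \<times> b)) *\<^sub>R c"
  by (simp add: cross3_simps forall_3)

lemma norm_cross3_le: "norm (x \<times> y) \<le> norm x * norm y" for x y :: "real ^ 3"
proof -
  have "(norm (x \<times> y))\<^sup>2 \<le> (norm x * norm y)\<^sup>2"
    using norm_cross_dot[of x y] by (smt (verit) zero_le_power2)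
  then show ?thesis
    by (simp add: power2_le_iff_abs_le)
qed

lemma abs_triple_product_le:
  fixes x y z :: "real ^ 3"
  assumes "norm y \<le> h" "norm z \<le> h"
  shows "\<bar>x \<bullet> (y \<times> z)\<bar> \<le> norm x * h\<^sup>2"
proof -
  have "0 \<le> h"
    using assms(1) norm_ge_zero order_trans by blast
  then have "norm y * norm z \<le> h\<^sup>2"
    using assms by (simp add: power2_eq_square mult_mono)
  then have "norm (y \<times> z) \<le> h\<^sup>2"
    using norm_cross3_le order_trans by blast
  then show ?thesis
    by (meson Cauchy_Schwarz_ineq2 mult_left_mono norm_ge_zero order_trans)
qed

text \<open>Six times the signed volume of the tetrahedron; its sign depends on the labelling, so it
  is used through its absolute value.\<close>

definition edge_volume :: "(nat \<Rightarrow> real ^ 3) \<Rightarrow> real" where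
  "edge_volume w = (w 2 - w 1) \<bullet> ((w 3 - w 1) \<times> (w 4 - w 1))"

text \<open>Absorbs the permutation into the labelling, so that only the chamber of
  \<open>id\<close> has to be studied.\<close>

lemma bipartite_cell_comp: "bipartite_cell v \<pi> = bipartite_cell (v \<circ> \<pi>) id"
  by (simp add: bipartite_cell_def)

lemma atLeastAtMost_1_4: "{1..4::nat} = {1, 2, 3, 4}"
  by auto

text \<open>The centre has barycentric coordinates 7/16, 5/16, 3/16, 1/16: consecutive gaps 1/8 and
  last value 1/16, hence it lies inside the chamber. The radius is chosen so that the coordinates of
  \<open>w 2\<close>, \<open>w 3\<close>, \<open>w 4\<close> move by at most 1/32 each.\<close>

lemma bipartite_cell_ball:
  fixes w :: "nat \<Rightarrow> real ^ 3"
  assumes D: "edge_volume w \<noteq> 0" and "0 < h"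
    and h: "\<And>i. i \<in> {1..4} \<Longrightarrow> norm (w i - w 1) \<le> h"
  shows "cball ((7/16) *\<^sub>R w 1 + (5/16) *\<^sub>R w 2 + (3/16) *\<^sub>R w 3 + (1/16) *\<^sub>R w 4)
           (\<bar>edge_volume w\<bar> / (32 * h\<^sup>2)) \<subseteq> bipartite_cell w id"
proof
  define p where "p = (7/16) *\<^sub>R w 1 + (5/16) *\<^sub>R w 2 + (3/16) *\<^sub>R w 3 + (1/16) *\<^sub>R w 4"
  define D where "D = edge_volume w"
  define a b c where "a = w 2 - w 1" and "b = w 3 - w 1" and "c = w 4 - w 1"
  fix x assume "x \<in> cball ((7/16) *\<^sub>R w 1 + (5/16) *\<^sub>R w 2 + (3/16) *\<^sub>R w 3 + (1/16) *\<^sub>R w 4)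
           (\<bar>edge_volume w\<bar> / (32 * h\<^sup>2))"
  then have x: "norm (x - p) \<le> \<bar>D\<bar> / (32 * h\<^sup>2)"
    by (simp add: p_def D_def dist_norm norm_minus_commute)
  have nz: "D \<noteq> 0" "D = a \<bullet> (b \<times> c)"
    using D by (simp_all add: D_def edge_volume_def a_def b_def c_def)
  have le: "norm a \<le> h" "norm b \<le> h" "norm c \<le> h"
    using h by (simp_all add: a_def b_def c_def)
  have small: "\<bar>(x - p) \<bullet> (y \<times> z) / D\<bar> \<le> 1/32" if "norm y \<le> h" "norm z \<le> h" for y z
  proof -
    have "\<bar>(x - p) \<bullet> (y \<times> z)\<bar> \<le> norm (x - p) * h\<^sup>2"
      using that by (rule abs_triple_product_le)
    also have "\<dots> \<le> \<bar>D\<bar> / (32 * h\<^sup>2) * h\<^sup>2"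
      using x by (intro mult_right_mono) auto
    also have "\<dots> = \<bar>D\<bar> / 32"
      using \<open>0 < h\<close> by simp
    finally show ?thesis
      using nz(1) by (simp add: abs_divide divide_le_eq)
  qed
  \<comment> \<open>The changes in the coordinates of \<open>w 2\<close>, \<open>w 3\<close>,
    \<open>w 4\<close>; that of \<open>w 1\<close> changes by -(s + t + u).\<close>
  define s t u where "s = (x - p) \<bullet> (b \<times> c) / D" and "t = (x - p) \<bullet> (c \<times> a) / D"
    and "u = (x - p) \<bullet> (a \<times> b) / D"
  have bounds: "\<bar>s\<bar> \<le> 1/32" "\<bar>t\<bar> \<le> 1/32" "\<bar>u\<bar> \<le> 1/32"
    unfolding s_def t_def u_def using small le by blast+
  have "x - p = (1 / D) *\<^sub>R (D *\<^sub>R (x - p))"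
    using nz by simp
  also have "\<dots> = s *\<^sub>R a + t *\<^sub>R b + u *\<^sub>R c"
    using cramer_cross3[of a b c "x - p"]
    by (simp add: s_def t_def u_def flip: nz(2)) (simp add: scaleR_add_right)
  finally have xp: "x = p + s *\<^sub>R a + t *\<^sub>R b + u *\<^sub>R c"
    by (simp add: algebra_simps)
  \<comment> \<open>\<open>\<mu> i = i (\<lambda>\<^sub>i - \<lambda>\<^sub>i\<^sub>+\<^sub>1)\<close> with \<open>\<lambda>\<^sub>5 = 0\<close>, where \<open>\<lambda>\<close> are the barycentric coordinates of \<open>x\<close> in \<open>w\<close>\<close>
  define \<mu> :: "nat \<Rightarrow> real" where
    "\<mu> i = (if i = 1 then 1/8 - 2 * s - t - u else if i = 2 then 2 * (1/8 + s - t)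
            else if i = 3 then 3 * (1/8 + t - u) else 4 * (1/16 + u))" for i
  have "(\<Sum>i\<in>{1..4}. \<mu> i *\<^sub>R ((1 / real i) *\<^sub>R (\<Sum>l=1..i. w (id l)))) \<in> bipartite_cell w id"
    unfolding bipartite_cell_def
  proof (rule convex_sum)
    show "sum \<mu> {1..4} = 1"
      unfolding atLeastAtMost_1_4 by (simp add: \<mu>_def)
    \<comment> \<open>The tight case is \<open>\<mu> 1\<close>: the first gap 1/8 can lose up to
      4/32. This is where the bound 1/32 comes from.\<close>
    show "0 \<le> \<mu> i" for i
      using bounds by (auto simp: \<mu>_def)
  qed (auto intro: hull_inc)
  also have "(\<Sum>i\<in>{1..4}. \<mu> i *\<^sub>R ((1 / real i) *\<^sub>R (\<Sum>l=1..i. w (id l)))) = x"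
  proof -
    have "{1..2::nat} = {1, 2}" "{1..3::nat} = {1, 2, 3}" "{1..4::nat} = {1, 2, 3, 4}"
      by auto
    then show ?thesis
      unfolding xp p_def a_def b_def c_def
      by (simp add: \<mu>_def) (simp add: vec_eq_iff field_simps)
  qed
  finally show "x \<in> bipartite_cell w id" .
qed

section \<open>Estimates for inball, volume, diameter and mean ratio\<close>

lemma regularity_le:
  assumes "bounded L" "cball p r \<subseteq> L" "0 < r"
  shows "regularity L \<le> diameter L / (2 * r)"
proof -
  have "2 * r \<le> inball_diameter L"
    unfolding inball_diameter_def
  proof (rule cSup_upper)
    show "2 * r \<in> {diameter (cball c r) | c r. 0 < r \<and> cball c r \<subseteq> L}"
      using assms by (auto intro!: exI[of _ p] exI[of _ r])
    show "bdd_above {diameter (cball c r) | c r. 0 < r \<and> cball c r \<subseteq> L}"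
      by (rule bdd_aboveI[of _ "diameter L"]) (use diameter_subset[OF _ \<open>bounded L\<close>] in blast)
  qed
  moreover have "0 \<le> diameter L"
    using \<open>bounded L\<close> by (rule diameter_ge_0)
  ultimately show "regularity L \<le> diameter L / (2 * r)"
    unfolding regularity_def using \<open>0 < r\<close>
    by (intro divide_left_mono) auto
qed

lemma measure_tetrahedron_pos:
  assumes "tetrahedron K"
  shows "0 < measure lebesgue K"
proof -
  have K: "convex K" "compact K" "aff_dim K = 3"
    using assms convex_simplex compact_simplex aff_dim_simplex by blast+
  have "interior K \<noteq> {}"
    using K rel_interior_eq_empty[OF K(1)] by (auto simp: interior_rel_interior_gen)
  then have "\<not> negligible K"
    using K(1) negligible_convex_interior by blast
  moreover have "K \<in> lmeasurable"
    using K(2) by (simp add: lmeasurable_compact)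
  ultimately show ?thesis
    by (metis completion.complete2 measure_nonneg negligible_iff_measure order_le_less)
qed

text \<open>Distances in a hull are extremal at generators. For a tetrahedron, this makes the
  diameter the length of an edge.\<close>

lemma diameter_convex_hull_finite:
  fixes C :: "'a::euclidean_space set"
  assumes "finite C" "C \<noteq> {}"
  obtains a b where "a \<in> C" "b \<in> C" "diameter (convex hull C) = dist a b"
proof -
  obtain a b where ab: "a \<in> C" "b \<in> C"
    "\<And>x y. x \<in> convex hull C \<Longrightarrow> y \<in> convex hull C \<Longrightarrow> norm (x - y) \<le> norm (a - b)"
    using simplex_extremal_le[OF assms] by blast
  have "bounded (convex hull C)"
    using assms(1) by (simp add: finite_imp_bounded_convex_hull)
  then have "dist a b \<le> diameter (convex hull C)"
    using ab by (intro diameter_bounded_bound) (auto intro: hull_inc)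
  moreover have "diameter (convex hull C) \<le> dist a b"
    using ab(3) by (intro diameter_le) (auto simp: dist_norm)
  ultimately show thesis
    using that ab by force
qed

lemma diameter_le_sum_edges:
  assumes "tetrahedron K"
  shows "(diameter K)\<^sup>2 \<le> (\<Sum>\<sigma> | \<sigma> edge_of K. (diameter \<sigma>)\<^sup>2)" "0 < diameter K"
proof -
  obtain C where C: "\<not> affine_dependent C" "int (card C) = 3 + 1" "K = convex hull C"
    using assms unfolding simplex_def by blast
  have fin: "finite C" "C \<noteq> {}"
    using C(2) card.infinite by fastforce+
  obtain a b where ab: "a \<in> C" "b \<in> C" "diameter K = dist a b"
    using diameter_convex_hull_finite[OF fin] C(3) by blast
  \<comment> \<open>A further vertex \<open>c\<close> makes the diameter positive; this forces
    \<open>a\<close> and \<open>b\<close> apart, so that their hull is a genuine edge.\<close>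
  have "\<not> C \<subseteq> {a}"
    using C(2) card_mono[of "{a}" C] by auto
  then obtain c where c: "c \<in> C" "c \<noteq> a"
    by blast
  have "bounded K"
    using C(3) fin by (simp add: finite_imp_bounded_convex_hull)
  then have "dist a c \<le> diameter K"
    using ab(1) c(1) C(3) by (intro diameter_bounded_bound) (auto intro: hull_inc)
  with c(2) show pos: "0 < diameter K"
    by (smt (verit) zero_less_dist_iff)
  let ?e = "convex hull {a, b}"
  have "a \<noteq> b"
    using pos ab(3) by auto
  then have edge: "?e edge_of K"
    using C ab unfolding edge_of_def
    by (auto simp: face_of_convex_hull_affine_independent aff_dim_convex_hull aff_dim_2
        intro!: exI[of _ "{a, b}"])
  \<comment> \<open>A sum over an infinite set would be 0 by convention, so finiteness is what lets
    a single edge bound the sum from below.\<close>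
  have "finite {\<sigma>. \<sigma> edge_of K}"
    using finite_polytope_faces[OF simplex_imp_polytope[OF assms]]
    by (rule rev_finite_subset) (auto simp: edge_of_def)
  moreover have "diameter ?e \<ge> diameter K"
    unfolding ab(3)
    by (intro diameter_bounded_bound) (auto simp: finite_imp_bounded_convex_hull hull_inc)
  ultimately have "(diameter K)\<^sup>2 \<le> (diameter ?e)\<^sup>2"
    using pos by (intro power_mono) auto
  also have "\<dots> \<le> (\<Sum>\<sigma> | \<sigma> edge_of K. (diameter \<sigma>)\<^sup>2)"
    using edge \<open>finite {\<sigma>. \<sigma> edge_of K}\<close> by (intro member_le_sum) auto
  finally show "(diameter K)\<^sup>2 \<le> (\<Sum>\<sigma> | \<sigma> edge_of K. (diameter \<sigma>)\<^sup>2)" .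
qed

lemma mean_ratio_pos:
  assumes "tetrahedron K"
  shows "0 < mean_ratio K"
proof -
  have "0 < (\<Sum>\<sigma> | \<sigma> edge_of K. (diameter \<sigma>)\<^sup>2)"
    using diameter_le_sum_edges[OF assms] by (smt (verit) zero_less_power)
  then show ?thesis
    using measure_tetrahedron_pos[OF assms] by (simp add: mean_ratio_def)
qed

text \<open>Cubing removes the fractional exponent and gives the constant 12^3 * 3^2 = 15552; the
  edge sum is then replaced by its lower bound, the squared diameter.\<close>

lemma mean_ratio_cube_le:
  assumes "tetrahedron K"
  shows "(mean_ratio K) ^ 3 \<le> 15552 * (measure lebesgue K)\<^sup>2 / (diameter K) ^ 6"
proof -
  let ?V = "measure lebesgue K" and ?S = "\<Sum>\<sigma> | \<sigma> edge_of K. (diameter \<sigma>)\<^sup>2"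
  have V: "0 < ?V"
    using measure_tetrahedron_pos[OF assms] .
  have "((3 * ?V) powr (2/3)) ^ 3 = (3 * ?V)\<^sup>2"
    using V by (simp add: powr_power)
  then have "(mean_ratio K) ^ 3 = 15552 * ?V\<^sup>2 / ?S ^ 3"
    by (simp add: mean_ratio_def power_divide power_mult_distrib)
  also have "((diameter K)\<^sup>2) ^ 3 \<le> ?S ^ 3"
    using diameter_le_sum_edges(1)[OF assms] by (intro power_mono) auto
  then have "15552 * ?V\<^sup>2 / ?S ^ 3 \<le> 15552 * ?V\<^sup>2 / ((diameter K)\<^sup>2) ^ 3"
    using diameter_le_sum_edges[OF assms]
    by (intro divide_left_mono mult_pos_pos zero_less_power)
      (auto intro: less_le_trans[of 0 "(diameter K)\<^sup>2"])
  finally show ?thesis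
    by simp
qed

lemma measure_tetrahedron:
  fixes w :: "nat \<Rightarrow> real ^ 3"
  assumes w: "inj_on w {1..4}"
  shows "measure lebesgue (convex hull (w ` {1..4})) = \<bar>edge_volume w\<bar> / 6"
proof -
  \<comment> \<open>The determinant formula for simplices is indexed by the type \<open>3\<close>,
    so the vertices other than \<open>w 1\<close> are enumerated by that type.\<close>
  define f :: "3 \<Rightarrow> real ^ 3" where "f j = w (if j = 1 then 2 else if j = 2 then 3 else 4)" for j
  have dist: "w 1 \<noteq> w 2" "w 1 \<noteq> w 3" "w 1 \<noteq> w 4" "w 2 \<noteq> w 3" "w 2 \<noteq> w 4" "w 3 \<noteq> w 4"
    using w unfolding atLeastAtMost_1_4 by (auto simp: inj_on_def)
  have f: "f 1 = w 2" "f 2 = w 3" "f 3 = w 4"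
    by (simp_all add: f_def)
  have bij: "bij_betw f UNIV (w ` {1..4} - {w 1})"
    unfolding bij_betw_def inj_on_def atLeastAtMost_1_4 UNIV_3
    using dist f by auto
  have "measure lborel (convex hull (w ` {1..4})) =
      \<bar>det (\<chi> i j. f j $ i - w 1 $ i)\<bar> / fact CARD(3)"
    using w bij by (intro content_simplex) (auto simp: card_image)
  moreover have "det (\<chi> i j. f j $ i - w 1 $ i) = edge_volume w"
    by (simp add: f edge_volume_def cross3_simps)
  \<comment> \<open>Borel measurability allows passing from \<open>lborel\<close> to its
    completion.\<close>
  moreover have "convex hull (w ` {1..4}) \<in> sets borel"
    by (simp add: borel_compact finite_imp_compact_convex_hull)
  ultimately show ?thesis
    by (simp add: fact_numeral measure_completion)
qed

section \<open>Regularity of the cells of one tetrahedron\<close>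

lemma bipartite_cell_subset: "bipartite_cell w id \<subseteq> convex hull (w ` {1..4})"
  unfolding bipartite_cell_def
proof (rule hull_minimal, safe)
  fix i :: nat assume i: "i \<in> {1..4}"
  have "(\<Sum>l=1..i. (1 / real i) *\<^sub>R w l) \<in> convex hull (w ` {1..4})"
    using i by (intro convex_sum) (auto intro!: hull_inc)
  then show "(1 / real i) *\<^sub>R (\<Sum>l=1..i. w (id l)) \<in> convex hull (w ` {1..4})"
    by (simp add: scaleR_sum_right)
qed

text \<open>Affine independence makes the extreme points of \<open>K\<close> exactly its spanning
  set, so a labelling composed with a permutation is again a labelling.\<close>

lemma bipartite_griddingE:
  assumes "tetrahedron K" "L \<in> bipartite_gridding K"
  obtains w where "inj_on w {1..4}" "K = convex hull (w ` {1..4})" "L = bipartite_cell w id"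
proof -
  obtain C where C: "\<not> affine_dependent C" "K = convex hull C"
    using assms(1) unfolding simplex_def by blast
  have ext: "{x. x extreme_point_of K} = C"
    using C by (simp add: extreme_point_of_convex_hull_affine_independent)
  obtain v \<pi> where v: "L = bipartite_cell v \<pi>" "bij_betw v {1..4} C" "\<pi> permutes {1..4}"
    using assms(2) unfolding bipartite_gridding_def ext by blast
  have "bij_betw (v \<circ> \<pi>) {1..4} C"
    using v permutes_imp_bij bij_betw_trans by blast
  then show thesis
    using C(2) v(1) bipartite_cell_comp by (intro that[of "v \<circ> \<pi>"]) (auto simp: bij_betw_def)
qed

lemma regularity_bipartite_gridding_le:
  assumes "tetrahedron K" "L \<in> bipartite_gridding K"
  shows "regularity L \<le> 6912 / (mean_ratio K) ^ 3"
proof -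
  obtain w where w: "inj_on w {1..4}" "K = convex hull (w ` {1..4})" "L = bipartite_cell w id"
    using bipartite_griddingE[OF assms] .
  define h V r where "h = diameter K" and "V = measure lebesgue K"
    and "r = \<bar>edge_volume w\<bar> / (32 * h\<^sup>2)"
  have h: "0 < h" and V: "0 < V"
    unfolding h_def V_def
    using diameter_le_sum_edges(2) measure_tetrahedron_pos assms(1) by auto
  have VD: "\<bar>edge_volume w\<bar> = 6 * V"
    using measure_tetrahedron[OF w(1)] w(2) by (simp add: V_def)
  have bounded: "bounded K"
    using w(2) by (simp add: finite_imp_bounded_convex_hull)
  have le: "norm (w i - w 1) \<le> h" if "i \<in> {1..4}" for i
    unfolding h_def dist_norm[symmetric] w(2) using that bounded w(2)
    by (intro diameter_bounded_bound) (auto intro: hull_inc)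
  have "L \<subseteq> K"
    using w bipartite_cell_subset by blast
  then have L: "bounded L" "diameter L \<le> h"
    using bounded bounded_subset diameter_subset h_def by blast+
  have r: "0 < r"
    using h V VD by (simp add: r_def)
  have ball: "cball ((7/16) *\<^sub>R w 1 + (5/16) *\<^sub>R w 2 + (3/16) *\<^sub>R w 3 + (1/16) *\<^sub>R w 4) r \<subseteq> L"
    unfolding r_def w(3) using V VD h le by (intro bipartite_cell_ball) auto
  \<comment> \<open>The triple product of three edge vectors of length at most \<open>h\<close>;
    this bounds the scale-invariant ratio left over at the end.\<close>
  have "6 * V \<le> norm (w 2 - w 1) * h\<^sup>2"
    using le abs_triple_product_le VD unfolding edge_volume_def
    by (metis atLeastAtMost_1_4 insertCI)
  also have "\<dots> \<le> h * h\<^sup>2"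
    using le by (intro mult_right_mono) auto
  finally have Vh: "6 * V \<le> h ^ 3"
    by (simp add: power_numeral_reduce)
  have "regularity L \<le> diameter L / (2 * r)"
    using regularity_le[OF L(1) ball r] .
  also have "\<dots> \<le> h / (2 * r)"
    using L(2) r by (intro divide_right_mono) auto
  also have "\<dots> = 16 * h ^ 3 / (6 * V)"
    unfolding r_def VD using h V by (simp add: field_simps power_numeral_reduce)
  finally have "regularity L \<le> 16 * h ^ 3 / (6 * V)" .
  then have "regularity L * (mean_ratio K) ^ 3
      \<le> 16 * h ^ 3 / (6 * V) * (15552 * V\<^sup>2 / h ^ 6)"
    using mean_ratio_cube_le[OF assms(1)] mean_ratio_pos[OF assms(1)] h V
    unfolding h_def[symmetric] V_def[symmetric] by (intro mult_mono) auto
  \<comment> \<open>16 * 15552 / 6 = 6 * 6912, with the factor 6 kept aside to match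
    \<open>Vh\<close>.\<close>
  also have "\<dots> = 6912 * (6 * V / h ^ 3)"
    using h V by (simp add: field_simps power_numeral_reduce)
  also have "\<dots> \<le> 6912"
    using Vh h by (simp add: divide_le_eq)
  finally show "regularity L \<le> 6912 / (mean_ratio K) ^ 3"
    using mean_ratio_pos[OF assms(1)] by (simp add: pos_le_divide_eq)
qed

section \<open>Finiteness and nonemptiness of griddings and meshes\<close>

lemma bipartite_gridding_nonempty:
  assumes "tetrahedron K"
  shows "bipartite_gridding K \<noteq> {}"
proof -
  obtain C where C: "\<not> affine_dependent C" "int (card C) = 3 + 1" "K = convex hull C"
    using assms unfolding simplex_def by blast
  have "{x. x extreme_point_of K} = C"
    using C by (simp add: extreme_point_of_convex_hull_affine_independent)
  moreover have "\<exists>v. bij_betw v {1..4::nat} C"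
    using C(1,2) by (intro finite_same_card_bij) (auto simp: aff_independent_finite)
  ultimately show ?thesis
    unfolding bipartite_gridding_def using permutes_id by blast
qed

lemma finite_bipartite_gridding:
  assumes "tetrahedron K"
  shows "finite (bipartite_gridding K)"
proof -
  let ?X = "{x. x extreme_point_of K}"
  have fin: "finite ?X"
    using finite_polyhedron_extreme_points simplex_imp_polyhedron[OF assms] by blast
  \<comment> \<open>Labellings are arbitrary outside \<open>{1..4}\<close>, so there are infinitely
    many; a cell depends only on the values there, and the extensional ones form a finite
    set.\<close>
  have "bipartite_gridding K \<subseteq> (\<lambda>v. bipartite_cell v id) ` ({1..4} \<rightarrow>\<^sub>E ?X)"
  proof
    fix L assume "L \<in> bipartite_gridding K"
    then obtain v \<pi> where v: "L = bipartite_cell v \<pi>" "bij_betw v {1..4} ?X" "\<pi> permutes {1..4}"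
      unfolding bipartite_gridding_def by blast
    have "bij_betw (v \<circ> \<pi>) {1..4} ?X"
      using v permutes_imp_bij bij_betw_trans by blast
    then have "restrict (v \<circ> \<pi>) {1..4} \<in> {1..4} \<rightarrow>\<^sub>E ?X"
      by (auto simp: bij_betw_def)
    moreover have "L = bipartite_cell (restrict (v \<circ> \<pi>) {1..4}) id"
      unfolding v(1) bipartite_cell_def by (intro arg_cong[where f = "(hull) convex"] image_cong) auto
    ultimately show "L \<in> (\<lambda>v. bipartite_cell v id) ` ({1..4} \<rightarrow>\<^sub>E ?X)"
      by blast
  qed
  then show ?thesis
    using fin by (meson finite_subset finite_imageI finite_PiE finite_atLeastAtMost)
qed

lemma tetrahedral_mesh_finite_nonempty:
  assumes "tetrahedral_mesh \<Omega> M" "\<Omega> \<noteq> {}"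
  shows "finite M" "M \<noteq> {}"
proof -
  show "finite M"
    using assms(1) by (simp add: tetrahedral_mesh_def triangulation_def)
  have "closure \<Omega> = \<Union>M"
    using assms(1) by (simp add: tetrahedral_mesh_def)
  then show "M \<noteq> {}"
    using assms(2) by auto
qed

section \<open>The uniform bound over all refinement levels\<close>

lemma regularity_bipartite_refinement_le:
  assumes T: "tetrahedral_mesh \<Omega> T" "\<Omega> \<noteq> {}" and Q: "qlrs_meshes \<Omega> T Q"
    and L: "L \<in> bipartite_refinement (Q n)"
  shows "regularity L \<le> 2299968 / (Min (mean_ratio ` T)) ^ 3"
proof -
  define \<eta> and c :: real where "\<eta> = Min (mean_ratio ` T)" and "c = root 3 4 / 11"
  have fin: "finite T" "T \<noteq> {}"
    using tetrahedral_mesh_finite_nonempty[OF T] .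
  have tetT: "\<forall>\<Delta>\<in>T. tetrahedron \<Delta>"
    using T(1) by (simp add: tetrahedral_mesh_def)
  have \<eta>: "0 < \<eta>"
    using fin tetT mean_ratio_pos by (auto simp: \<eta>_def)
  obtain K where K: "K \<in> Q n" "L \<in> bipartite_gridding K"
    using L by (auto simp: bipartite_refinement_def)
  have tetK: "tetrahedron K"
    using Q K(1) by (auto simp: qlrs_meshes_def tetrahedral_mesh_def)
  obtain \<Delta> where \<Delta>: "\<Delta> \<in> T" "c * mean_ratio \<Delta> \<le> mean_ratio K"
    using Q K(1) unfolding qlrs_meshes_def c_def by blast
  have c: "0 < c" "c ^ 3 = 4 / 1331"
    by (simp_all add: c_def power_divide)
  have "\<eta> \<le> mean_ratio \<Delta>"
    using fin(1) \<Delta>(1) by (simp add: \<eta>_def)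
  then have "c * \<eta> \<le> mean_ratio K"
    using \<Delta>(2) c(1) by (meson mult_left_mono less_imp_le order_trans)
  then have "(c * \<eta>) ^ 3 \<le> (mean_ratio K) ^ 3"
    using c(1) \<eta> by (intro power_mono) auto
  then have "6912 / (mean_ratio K) ^ 3 \<le> 6912 / (c * \<eta>) ^ 3"
    using c(1) \<eta> mean_ratio_pos[OF tetK] by (intro divide_left_mono) auto
  \<comment> \<open>6912 * 1331 / 4 = 2299968 = 132^3.\<close>
  also have "\<dots> = 2299968 / \<eta> ^ 3"
    by (simp add: power_mult_distrib c(2))
  finally show ?thesis
    using regularity_bipartite_gridding_le[OF tetK K(2)] by (simp add: \<eta>_def)
qed

theorem theorem4p7:
  shows "\<exists>\<kappa>::real. \<kappa> > 0 \<and>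
    (\<forall>(\<Omega> :: (real ^ 3) set) (T :: mesh) (Q :: nat \<Rightarrow> mesh).
       polyhedral_region \<Omega> \<longrightarrow> simply_connected \<Omega> \<longrightarrow>
       tetrahedral_mesh \<Omega> T \<longrightarrow> qlrs_meshes \<Omega> T Q \<longrightarrow>
         bounded_regularity (\<lambda>n. bipartite_refinement (Q n)) \<and>
         (SUP n. Max (regularity ` bipartite_refinement (Q n)))
           \<le> \<kappa> / (Min (mean_ratio ` T)) ^ 3)"
proof (intro exI[of _ 2299968] conjI allI impI)
  fix \<Omega> :: "(real ^ 3) set" and T :: mesh and Q :: "nat \<Rightarrow> mesh"
  assume "polyhedral_region \<Omega>" and T: "tetrahedral_mesh \<Omega> T" and Q: "qlrs_meshes \<Omega> T Q"
  \<comment> \<open>Rules out empty meshes, for which \<open>Min\<close> and \<open>Max\<close>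
    would be unspecified.\<close>
  then have ne: "\<Omega> \<noteq> {}"
    by (simp add: polyhedral_region_def)
  note bound = regularity_bipartite_refinement_le[OF T ne Q]
  show "bounded_regularity (\<lambda>n. bipartite_refinement (Q n))"
    unfolding bounded_regularity_def using bound by (auto intro!: bdd_aboveI)
  show "(SUP n. Max (regularity ` bipartite_refinement (Q n)))
      \<le> 2299968 / (Min (mean_ratio ` T)) ^ 3"
  proof (rule cSUP_least)
    fix n
    have mesh: "tetrahedral_mesh \<Omega> (Q n)"
      using Q by (simp add: qlrs_meshes_def)
    have "\<forall>K\<in>Q n. tetrahedron K"
      using mesh by (simp add: tetrahedral_mesh_def)
    \<comment> \<open>Only for a finite nonempty set is \<open>Max\<close> bounded by a common bound
      on the elements.\<close>
    then have "finite (bipartite_refinement (Q n))" "bipartite_refinement (Q n) \<noteq> {}"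
      using tetrahedral_mesh_finite_nonempty[OF mesh ne]
        finite_bipartite_gridding bipartite_gridding_nonempty
      by (auto simp: bipartite_refinement_def)
    then show "Max (regularity ` bipartite_refinement (Q n))
        \<le> 2299968 / (Min (mean_ratio ` T)) ^ 3"
      using bound by simp
  qed simp
qed simp

end
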